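(* Let $\nu\ge 0$ and let $g\in\widetilde{C}[0,\infty)\cap E$, where $\widetilde{C}[0,\infty)$ is the space of uniformly continuous functions on $[0,\infty)$ and $E$ is the set of functions $g$ on $[0,\infty)$ such that $\frac{g(x)}{1+x^2}$ converges (to a finite limit) as $x\to\infty$. Then for every integer $n>3$ and every $x\ge 0$, $$\left|T_n(g;x)-g(x)\right|\le\left(1+\sqrt{9x^2+\left(\frac{8\nu n-12\nu+2n}{n-2}\right)x}\,\right)\omega\left(g;\frac{1}{\sqrt{n}}\right).$$
   Context: Fix a real $\nu\ge 0$. For $r\in\mathbb{N}_0$ let $$\gamma_\nu(2r)=\frac{2^{2r}\,r!\,\Gamma(r+\nu+1/2)}{\Gamma(\nu+1/2)},\qquad \gamma_\nu(2r+1)=\frac{2^{2r+1}\,r!\,\Gamma(r+\nu+3/2)}{\Gamma(\nu+1/2)},$$ and $e_\nu(x)=\sum_{r=0}^{\infty}\frac{x^r}{\gamma_\nu(r)}$. For an integer $n\ge 1$, $x\ge 0$ and a continuous function $g$ on $[0,\infty)$ for which the integrals exist finitely, define $$T_n(g;x)=\frac{n-1}{e_\nu(nx)}\sum_{r=1}^{\infty}\binom{n+r-2}{r-1}\frac{(nx)^r}{\gamma_\nu(r)}\int_0^\infty s^{r-1}(1+s)^{-n-r+1}g(s)\,ds+\frac{g(0)}{e_\nu(nx)}.$$ The modulus of continuity is $\omega(g;\delta)=\sup\{|g(s)-g(t)|: s,t\in[0,\infty),\ |s-t|\le\delta\}$. *)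

theory Defs
  imports "HOL-Analysis.Analysis"
begin

definition dunkl_gamma :: "real \<Rightarrow> nat \<Rightarrow> real" where
  "dunkl_gamma \<nu> k =
     (if even k
      then 2 ^ k * fact (k div 2) * Gamma (real (k div 2) + \<nu> + 1 / 2) / Gamma (\<nu> + 1 / 2)
      else 2 ^ k * fact (k div 2) * Gamma (real (k div 2) + \<nu> + 3 / 2) / Gamma (\<nu> + 1 / 2))"

definition dunkl_exp :: "real \<Rightarrow> real \<Rightarrow> real" where
  "dunkl_exp \<nu> x = (\<Sum>r. x ^ r / dunkl_gamma \<nu> r)"

text \<open>
  The summand of index \<open>r \<ge> 1\<close> of the operator; for \<open>r \<ge> 1\<close> and \<open>n \<ge> 1\<close> the subtractions on
  natural numbers do not truncate.
\<close>

definition T_term :: "real \<Rightarrow> nat \<Rightarrow> (real \<Rightarrow> real) \<Rightarrow> real \<Rightarrow> nat \<Rightarrow> real" where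
  "T_term \<nu> n g x r =
     real ((n + r - 2) choose (r - 1)) * ((real n * x) ^ r / dunkl_gamma \<nu> r) *
     (LINT s:{0..}|lborel. s ^ (r - 1) * (1 + s) powi (- int n - int r + 1) * g s)"

definition T_op :: "real \<Rightarrow> nat \<Rightarrow> (real \<Rightarrow> real) \<Rightarrow> real \<Rightarrow> real" where
  "T_op \<nu> n g x =
     (real n - 1) / dunkl_exp \<nu> (real n * x) * (\<Sum>r. T_term \<nu> n g x (Suc r))
     + g 0 / dunkl_exp \<nu> (real n * x)"

text \<open>
  The supremum is taken in the reals, so it is meaningful only when the set is bounded above; this
  is the case when \<open>g\<close> is uniformly continuous on \<open>[0, \<infinity>)\<close>.
\<close>

definition modulus_of_continuity :: "(real \<Rightarrow> real) \<Rightarrow> real \<Rightarrow> real" where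
  "modulus_of_continuity g \<delta> = Sup {\<bar>g s - g t\<bar> | s t. 0 \<le> s \<and> 0 \<le> t \<and> \<bar>s - t\<bar> \<le> \<delta>}"

definition quadratic_growth_space :: "(real \<Rightarrow> real) set" where
  "quadratic_growth_space = {g. \<exists>L. ((\<lambda>x. g x / (1 + x\<^sup>2)) \<longlongrightarrow> L) at_top}"

end

theory Submission
  imports Defs
begin

text \<open>
  The operator is an average of \<open>g\<close> over a two-stage random point \<open>s\<close>. A natural number \<open>r\<close> is
  drawn with probability \<open>p\<^sub>r = (nx)\<^sup>r / (\<gamma>\<^sub>\<nu>(r) e\<^sub>\<nu>(nx))\<close>; then \<open>s = 0\<close> if \<open>r = 0\<close>, and otherwise
  \<open>s\<close> has the beta prime distribution with parameters \<open>r\<close> and \<open>n - 1\<close>. Since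
  \<open>\<bar>g s - g x\<bar> \<le> (1 + \<bar>s - x\<bar> / \<delta>) \<omega>(g; \<delta>)\<close>, with \<open>\<delta> = 1 / \<surd>n\<close>, everything comes down to bounding
  \<open>\<surd>n E\<bar>s - x\<bar>\<close> by the square root in the claim.

  The usual estimate \<open>E\<bar>s - x\<bar> \<le> \<surd>(E (s - x)\<^sup>2)\<close> is too weak for this: for \<open>n = 4\<close> and \<open>\<nu> = 0\<close> it
  yields \<open>20x\<^sup>2 + 16x\<close> under the root, where \<open>9x\<^sup>2 + 4x\<close> is required, because the beta prime law has
  a heavy tail. The Cauchy--Schwarz inequality is therefore used with the weight \<open>1 + s\<close>, that is
  \<open>(E\<bar>s - u\<bar>)\<^sup>2 \<le> E ((s - u)\<^sup>2 / (1 + s)) E (1 + s)\<close>, in its pointwise form with a multiplier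
  (\<open>weighted_deviation_bound\<close>). Given \<open>r\<close> it only involves the beta prime means of \<open>1\<close>, \<open>s\<close> and
  \<open>1 / (1 + s)\<close>, which are \<open>1\<close>, \<open>r / (n - 2)\<close> and \<open>(n - 1) / (n - 1 + r)\<close>
  (\<open>beta_prime_mean_bound\<close>).

  The last of these is replaced by a quadratic polynomial in \<open>r\<close> (\<open>reciprocal_quadratic_bound\<close>), so
  that only the mean and the variance of \<open>r\<close> matter. With \<open>y = nx\<close> and \<open>A\<close> the probability that \<open>r\<close> is
  odd, the recursion for \<open>\<gamma>\<^sub>\<nu>\<close> gives the mean \<open>y - 2\<nu>A\<close>; this is \<open>nu\<close> where \<open>u = x - \<beta>\<close> and
  \<open>\<beta> = 2\<nu>A / n\<close> is the bias, and \<open>u\<close> is the centre about which the deviation is measured. The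
  variance is at most \<open>y\<close> (\<open>dunkl_variance_le\<close>). For \<open>\<nu> > 0\<close> this bound is equivalent to an inequality between
  the even and the odd part of \<open>e\<^sub>\<nu>\<close>, the Amos bound for a quotient of modified Bessel functions,
  and it is obtained from the differential equations of the two parts (\<open>even_odd_gap\<close>). The same
  inequality yields \<open>A \<le> 1 / 2\<close>, hence \<open>n\<beta> \<le> \<nu>\<close>.

  The result is
  \<open>E\<bar>s - x\<bar> \<le> \<beta> + \<surd>((2u / (n - 2) + \<beta> / n) (1 + nu / (n - 2)))\<close>. For \<open>\<nu> = 0\<close>, after
  multiplication by \<open>n\<close>, the right-hand side has \<open>2nx / (n - 2) + 2n\<^sup>2x\<^sup>2 / (n - 2)\<^sup>2\<close> under the root;
  the linear term is exactly the one claimed, and \<open>2n\<^sup>2 \<le> 9(n - 2)\<^sup>2\<close> holds from \<open>n = 4\<close> on. For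
  \<open>\<nu> > 0\<close> the cost of the bias is absorbed by the multiple of \<open>\<nu>x\<close> in the claim
  (\<open>bias_plus_root_le\<close>).
\<close>

section \<open>The modulus of continuity\<close>

text \<open>
  The segment between \<open>s\<close> and \<open>t\<close> is cut into \<open>\<lceil>\<bar>s - t\<bar> / \<delta>\<rceil>\<close> equal pieces of length at most \<open>\<delta>\<close>.
  The bound \<open>W\<close> is arbitrary because this is used twice: with \<open>W = 1\<close> to see that the supremum
  defining the modulus of continuity is over a bounded set, and then with that supremum as \<open>W\<close>.
\<close>
lemma subdivision_bound:
  fixes g :: "real \<Rightarrow> real"
  assumes W: "\<And>s t. 0 \<le> s \<Longrightarrow> 0 \<le> t \<Longrightarrow> \<bar>s - t\<bar> \<le> \<delta> \<Longrightarrow> \<bar>g s - g t\<bar> \<le> W"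
    and "\<delta> > 0" and "0 \<le> s" and "0 \<le> t"
  shows "\<bar>g s - g t\<bar> \<le> (1 + \<bar>s - t\<bar> / \<delta>) * W"
proof -
  have "W \<ge> 0" using W[of 0 0] \<open>\<delta> > 0\<close> by simp
  have steps: "\<bar>g s - g t\<bar> \<le> real N * W"
    if "0 \<le> s" "0 \<le> t" "\<bar>s - t\<bar> \<le> real N * \<delta>" for N s t
    using that
  proof (induction N arbitrary: t)
    case 0
    then show ?case by simp
  next
    case (Suc N)
    define R where "R = real (Suc N)"
    have R: "R > 0" "real N = R - 1" by (auto simp: R_def)
    \<comment> \<open>The end nearer to \<open>s\<close> of the last of \<open>N + 1\<close> equal pieces; \<open>N\<close> pieces remain up to \<open>s\<close>.\<close>
    define u where "u = (s + real N * t) / R"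
    have "u \<ge> 0" using Suc.prems R(1) by (simp add: u_def)
    have eq1: "s - u = (real N / real (Suc N)) * (s - t)"
      using R(1) unfolding u_def R(2) R_def[symmetric] by (simp add: field_simps)
    have eq2: "u - t = (1 / real (Suc N)) * (s - t)"
      using R(1) unfolding u_def R(2) R_def[symmetric] by (simp add: field_simps)
    have d: "\<bar>s - t\<bar> / real (Suc N) \<le> \<delta>"
      using Suc.prems by (simp add: field_simps)
    have "\<bar>s - u\<bar> = real N * (\<bar>s - t\<bar> / real (Suc N))"
      unfolding eq1 by (simp add: abs_mult)
    also have "\<dots> \<le> real N * \<delta>" using d by (intro mult_left_mono) auto
    finally have 1: "\<bar>g s - g u\<bar> \<le> real N * W"
      using Suc \<open>u \<ge> 0\<close> by blast
    have "\<bar>u - t\<bar> \<le> \<delta>" unfolding eq2 using d by (simp add: abs_mult)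
    then have "\<bar>g u - g t\<bar> \<le> W" using W \<open>u \<ge> 0\<close> Suc.prems by blast
    then show ?case using 1 by (simp add: algebra_simps)
  qed
  define N where "N = nat \<lceil>\<bar>s - t\<bar> / \<delta>\<rceil>"
  have "\<bar>s - t\<bar> / \<delta> \<ge> 0" using \<open>\<delta> > 0\<close> by simp
  then have N: "\<bar>s - t\<bar> / \<delta> \<le> real N" "real N \<le> 1 + \<bar>s - t\<bar> / \<delta>"
    unfolding N_def by linarith+
  have "\<bar>g s - g t\<bar> \<le> real N * W"
    using N(1) \<open>\<delta> > 0\<close> assms(3,4) by (intro steps) (auto simp: field_simps)
  also have "\<dots> \<le> (1 + \<bar>s - t\<bar> / \<delta>) * W"
    using N(2) \<open>W \<ge> 0\<close> by (intro mult_right_mono) auto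
  finally show ?thesis .
qed

lemma modulus_of_continuity_upper:
  assumes g: "uniformly_continuous_on {0..} g" and "0 \<le> s" "0 \<le> t" "\<bar>s - t\<bar> \<le> \<delta>"
  shows "\<bar>g s - g t\<bar> \<le> modulus_of_continuity g \<delta>"
proof -
  obtain d where d: "d > 0"
    and gd: "\<And>s t. 0 \<le> s \<Longrightarrow> 0 \<le> t \<Longrightarrow> \<bar>s - t\<bar> < d \<Longrightarrow> \<bar>g s - g t\<bar> < 1"
    using g unfolding uniformly_continuous_on_def dist_real_def
    by (metis atLeast_iff zero_less_one)
  have "\<bar>g s - g t\<bar> \<le> 1 + \<delta> / (d / 2)"
    if "0 \<le> s" "0 \<le> t" "\<bar>s - t\<bar> \<le> \<delta>" for s t
  proof -
    have "\<bar>g s - g t\<bar> \<le> (1 + \<bar>s - t\<bar> / (d / 2)) * 1"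
    proof (rule subdivision_bound)
      show "\<bar>g a - g b\<bar> \<le> 1" if "0 \<le> a" "0 \<le> b" "\<bar>a - b\<bar> \<le> d / 2" for a b
        using gd[of a b] that d by force
    qed (use d that in auto)
    also have "\<dots> \<le> 1 + \<delta> / (d / 2)"
      using that d by (auto intro: divide_right_mono)
    finally show ?thesis .
  qed
  then have "bdd_above {\<bar>g s - g t\<bar> | s t. 0 \<le> s \<and> 0 \<le> t \<and> \<bar>s - t\<bar> \<le> \<delta>}"
    by (intro bdd_aboveI) auto
  then show ?thesis
    unfolding modulus_of_continuity_def using assms by (intro cSup_upper) auto
qed

lemma modulus_of_continuity_bound:
  assumes "uniformly_continuous_on {0..} g" and "\<delta> > 0" "0 \<le> s" "0 \<le> t"
  shows "\<bar>g s - g t\<bar> \<le> (1 + \<bar>s - t\<bar> / \<delta>) * modulus_of_continuity g \<delta>"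
  using assms by (intro subdivision_bound modulus_of_continuity_upper)

section \<open>Averages over the beta prime distribution\<close>

text \<open>
  This is the beta integral with parameters \<open>p + 1\<close> and \<open>M + 1\<close>. For \<open>M = 0\<close> an antiderivative is
  \<open>(s / (1 + s))\<^bsup>p+1\<^esup> / (p + 1)\<close>, and multiplying the integrand by \<open>1 / (1 + s) = 1 - s / (1 + s)\<close>
  expresses the integral for \<open>M + 1\<close> as a difference of two integrals for \<open>M\<close>. Integrability comes
  along with the value.
\<close>
lemma beta_integral:
  "has_bochner_integral lborel (\<lambda>s::real. indicator {0..} s * (s ^ p / (1 + s) ^ (p + M + 2)))
     (fact p * fact M / fact (p + M + 1))"
proof (induction M arbitrary: p)
  case 0
  define F where "F = (\<lambda>s::real. (s / (1 + s)) ^ (p + 1) / real (p + 1))"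
  have nn: "(\<integral>\<^sup>+s. ennreal (s ^ p / (1 + s) ^ (p + 2)) * indicator {0..} s \<partial>lborel)
      = ennreal (1 / real (p + 1) - F 0)"
  proof (rule nn_integral_FTC_atLeast)
    fix s :: real assume s: "0 \<le> s"
    show "0 \<le> s ^ p / (1 + s) ^ (p + 2)" using s by simp
    have "((\<lambda>s. s / (1 + s)) has_real_derivative 1 / (1 + s)\<^sup>2) (at s)"
      using s by (auto intro!: derivative_eq_intros simp: power2_eq_square divide_simps)
    from DERIV_power[OF this, of "p + 1"]
    have "((\<lambda>s. (s / (1 + s)) ^ (p + 1)) has_real_derivative
        real (p + 1) * (1 / (1 + s)\<^sup>2 * (s / (1 + s)) ^ p)) (at s)"
      by simp
    from DERIV_cdivide[OF this, of "real (p + 1)"]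
    have "(F has_real_derivative 1 / (1 + s)\<^sup>2 * (s / (1 + s)) ^ p) (at s)"
      unfolding F_def by simp
    then show "(F has_real_derivative s ^ p / (1 + s) ^ (p + 2)) (at s)"
      by (simp add: power_divide power_add power2_eq_square mult_ac)
  next
    have "((\<lambda>s::real. 1 - inverse (1 + s)) \<longlongrightarrow> 1 - 0) at_top"
      by (intro tendsto_diff tendsto_const tendsto_inverse_0_at_top
          filterlim_tendsto_add_at_top[OF tendsto_const filterlim_ident])
    moreover have "eventually (\<lambda>s::real. 1 - inverse (1 + s) = s / (1 + s)) at_top"
      using eventually_ge_at_top[of 0] by eventually_elim (simp add: field_simps)
    ultimately have "((\<lambda>s::real. s / (1 + s)) \<longlongrightarrow> 1) at_top"
      by (simp add: filterlim_cong)
    then have "((\<lambda>s::real. (s / (1 + s)) ^ (p + 1) / real (p + 1)) \<longlongrightarrow> 1 ^ (p + 1) / real (p + 1)) at_top"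
      by (intro tendsto_divide tendsto_power tendsto_const) auto
    then show "(F \<longlongrightarrow> 1 / real (p + 1)) at_top" by (simp add: F_def)
  qed measurable
  have "has_bochner_integral lborel (\<lambda>s. indicator {0..} s * (s ^ p / (1 + s) ^ (p + 2)))
      (1 / real (p + 1))"
  proof (rule has_bochner_integral_nn_integral)
    show "(\<integral>\<^sup>+s. ennreal (indicator {0..} s * (s ^ p / (1 + s) ^ (p + 2))) \<partial>lborel)
        = ennreal (1 / real (p + 1))"
    proof -
      have "(\<integral>\<^sup>+s. ennreal (indicator {0..} s * (s ^ p / (1 + s) ^ (p + 2))) \<partial>lborel)
          = (\<integral>\<^sup>+s. ennreal (s ^ p / (1 + s) ^ (p + 2)) * indicator {0..} s \<partial>lborel)"
        by (intro nn_integral_cong) (auto split: split_indicator)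
      then show ?thesis using nn by (simp add: F_def)
    qed
  qed (auto split: split_indicator)
  then show ?case by simp
next
  case (Suc M)
  have eq: "indicator {0..} s * (s ^ p / (1 + s) ^ (p + M + 2))
      - indicator {0..} s * (s ^ Suc p / (1 + s) ^ (Suc p + M + 2))
      = indicator {0..} s * (s ^ p / (1 + s) ^ (p + Suc M + 2))" for s :: real
  proof (cases "0 \<le> s")
    case True
    have frac: "P / D - (c - 1) * P / (c * D) = P / (c * D)" if "c > 0" "D > 0" for P D c :: real
      using that by (simp add: field_simps)
    show ?thesis
      using frac[of "1 + s" "(1 + s) ^ (p + M + 2)" "s ^ p"] True by (simp del: power_Suc2)
  qed simp
  have val: "fact p * fact M / fact (p + M + 1) - fact (Suc p) * fact M / fact (Suc p + M + 1)
      = (fact p * fact (Suc M) / fact (p + Suc M + 1) :: real)"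
  proof -
    have frac: "a / q - k * a / (c * q) = (c - k) * a / (c * q)" if "c > 0" "q > 0" for a q c k :: real
      using that by (simp add: field_simps)
    show ?thesis
      using frac[of "real (p + M + 2)" "fact (p + M + 1)" "fact p * fact M" "real (p + 1)"]
      by (simp add: mult_ac)
  qed
  show ?case
    using has_bochner_integral_diff[OF Suc.IH[of p] Suc.IH[of "Suc p"]] unfolding eq val .
qed

text \<open>
  The point \<open>s = 0\<close> that \<open>T_op\<close> attaches to \<open>r = 0\<close> is the degenerate beta prime law with first
  parameter \<open>0\<close>: the mean \<open>r / (n - 2)\<close> of \<open>s\<close> and the mean \<open>(n - 1) / (n - 1 + r)\<close> of \<open>1 / (1 + s)\<close>
  hold for it as well.
\<close>
definition beta_prime_mean :: "nat \<Rightarrow> (real \<Rightarrow> real) \<Rightarrow> nat \<Rightarrow> real" where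
  "beta_prime_mean n g r =
     (if r = 0 then g 0
      else (real n - 1) * real ((n + r - 2) choose (r - 1)) *
        (LINT s:{0..}|lborel. s ^ (r - 1) * (1 + s) powi (- int n - int r + 1) * g s))"

text \<open>
  The majorant only contains functions whose beta prime means are explicit: multiplying the density
  by \<open>1 + s\<close> or \<open>1 / (1 + s)\<close> shifts the second parameter by one. The majorant also supplies the
  integrability of \<open>g\<close>.
\<close>
lemma beta_prime_mean_bound:
  fixes g :: "real \<Rightarrow> real"
  assumes n: "n \<ge> 3" and g: "continuous_on {0..} g"
    and bound: "\<And>s. s \<ge> 0 \<Longrightarrow> \<bar>g s - c\<bar> \<le> a * (1 + s) + b / (1 + s) + k"
  shows "\<bar>beta_prime_mean n g r - c\<bar>
    \<le> a * (1 + real r / (real n - 2)) + b * ((real n - 1) / (real n - 1 + real r)) + k"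
proof (cases r)
  case 0
  then show ?thesis using bound[of 0] n by (simp add: beta_prime_mean_def)
next
  case (Suc q)
  obtain N where N: "n = N + 3" using n by (metis add.commute le_Suc_ex)
  define C where "C = (real n - 1) * real ((n + q - 1) choose q)"
  define w where "w = (\<lambda>s::real. C * (indicator {0..} s * (s ^ q / (1 + s) ^ (n + q))))"
  have C: "C = fact (q + N + 2) / (fact q * fact (N + 1))"
  proof -
    have "real (N + 2) * (b / (a * (real (N + 2) * fact (N + 1)))) = b / (a * fact (N + 1))" for a b :: real
      by (simp del: of_nat_add)
    from this[of "fact (q + N + 2)" "fact q"] show ?thesis
      using fact_Suc[of "N + 1", where 'a = real] unfolding C_def N
      by (simp add: binomial_fact add.commute add.left_commute del: fact_Suc)
  qed
  have "C \<ge> 0" by (simp add: C)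
  have w_nonneg: "w s \<ge> 0" for s
    using \<open>C \<ge> 0\<close> by (auto simp: w_def split: split_indicator)
  have w1: "has_bochner_integral lborel w 1"
  proof -
    have "C * (fact q * fact (N + 1) / fact (q + (N + 1) + 1)) = 1" by (simp add: C add.commute)
    moreover have "n + q = q + (N + 1) + 2" by (simp add: N)
    ultimately show ?thesis
      using has_bochner_integral_mult_right[OF beta_integral[of q "N + 1"], of C]
      unfolding w_def by (simp only:)
  qed
  have ws: "has_bochner_integral lborel (\<lambda>s. w s * (1 + s)) (1 + real r / (real n - 2))"
  proof -
    have "real (q + N + 2) * F / (Q * (real (N + 1) * G)) * (Q * G / F) = 1 + real r / (real n - 2)"
      if "F > 0" "Q > 0" "G > 0" for F Q G :: real
      using that by (simp add: Suc N divide_simps)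
    from this[of "fact (q + N + 1)" "fact q" "fact N"]
    have "C * (fact q * fact N / fact (q + N + 1)) = 1 + real r / (real n - 2)"
      using fact_Suc[of "q + N + 1", where 'a = real] fact_Suc[of N, where 'a = real]
      unfolding C by (simp del: fact_Suc)
    moreover have "w s * (1 + s) = C * (indicator {0..} s * (s ^ q / (1 + s) ^ (q + N + 2)))" for s
    proof (cases "s \<ge> 0")
      case True
      have "(1 + s) ^ (n + q) = (1 + s) ^ Suc (q + N + 2)" by (rule arg_cong) (simp add: N)
      then show ?thesis using True unfolding w_def by (simp only: power_Suc) simp
    qed (simp add: w_def)
    ultimately show ?thesis
      using has_bochner_integral_mult_right[OF beta_integral[of q N], of C] by simp
  qed
  have wi: "has_bochner_integral lborel (\<lambda>s. w s / (1 + s)) ((real n - 1) / (real n - 1 + real r))"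
  proof -
    have "F / (Q * G) * (Q * (real (N + 2) * G) / (real (q + N + 3) * F)) = (real n - 1) / (real n - 1 + real r)"
      if "F > 0" "Q > 0" "G > 0" for F Q G :: real
      using that by (simp add: Suc N divide_simps)
    from this[of "fact (q + N + 2)" "fact q" "fact (N + 1)"]
    have "C * (fact q * fact (N + 2) / fact (q + (N + 2) + 1)) = (real n - 1) / (real n - 1 + real r)"
      using fact_Suc[of "q + N + 2", where 'a = real] fact_Suc[of "N + 1", where 'a = real]
      unfolding C by (simp add: numeral_3_eq_3 del: fact_Suc)
    moreover have "w s / (1 + s) = C * (indicator {0..} s * (s ^ q / (1 + s) ^ (q + (N + 2) + 2)))" for s
    proof (cases "s \<ge> 0")
      case True
      have "(1 + s) ^ (q + (N + 2) + 2) = (1 + s) ^ Suc (n + q)" by (rule arg_cong) (simp add: N)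
      then show ?thesis using True unfolding w_def by (simp only: power_Suc) simp
    qed (simp add: w_def)
    ultimately show ?thesis
      using has_bochner_integral_mult_right[OF beta_integral[of q "N + 2"], of C] by simp
  qed
  have major: "has_bochner_integral lborel (\<lambda>s. a * (w s * (1 + s)) + b * (w s / (1 + s)) + k * w s)
      (a * (1 + real r / (real n - 2)) + b * ((real n - 1) / (real n - 1 + real r)) + k * 1)"
    by (intro has_bochner_integral_add has_bochner_integral_mult_right ws wi w1)
  define f where "f = (\<lambda>s. w s * (g s - c))"
  have f_le: "\<bar>f s\<bar> \<le> a * (w s * (1 + s)) + b * (w s / (1 + s)) + k * w s" for s
  proof (cases "s \<ge> 0")
    case True
    have "\<bar>f s\<bar> = w s * \<bar>g s - c\<bar>" using w_nonneg[of s] by (simp add: f_def abs_mult)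
    also have "\<dots> \<le> w s * (a * (1 + s) + b / (1 + s) + k)"
      using w_nonneg bound[OF True] by (rule mult_left_mono[rotated])
    finally show ?thesis by (simp add: algebra_simps)
  qed (simp add: f_def w_def)
  have "(\<lambda>s. indicator {0..} s *\<^sub>R (C * (s ^ q / (1 + s) ^ (n + q)) * (g s - c))) \<in> borel_measurable borel"
    by (intro borel_measurable_continuous_on_indicator continuous_intros g) auto
  then have f_meas: "f \<in> borel_measurable lborel"
    by (simp add: f_def w_def mult_ac)
  have f_int: "integrable lborel f"
    using f_le by (intro Bochner_Integration.integrable_bound[OF integrable.intros[OF major] f_meas])
      (auto intro: order_trans[OF _ abs_ge_self])
  have "\<bar>integral\<^sup>L lborel f\<bar> \<le> integral\<^sup>L lborel (\<lambda>s. \<bar>f s\<bar>)" by (rule integral_abs_bound)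
  also have "\<dots> \<le> (LINT s|lborel. a * (w s * (1 + s)) + b * (w s / (1 + s)) + k * w s)"
    using f_int integrable.intros[OF major] f_le by (intro integral_mono) auto
  also have "\<dots> = a * (1 + real r / (real n - 2)) + b * ((real n - 1) / (real n - 1 + real r)) + k"
    using has_bochner_integral_integral_eq[OF major] by simp
  finally have le: "\<bar>integral\<^sup>L lborel f\<bar>
    \<le> a * (1 + real r / (real n - 2)) + b * ((real n - 1) / (real n - 1 + real r)) + k" .
  have wc: "has_bochner_integral lborel (\<lambda>s. c * w s) (c * 1)"
    by (intro has_bochner_integral_mult_right w1)
  have "integral\<^sup>L lborel (\<lambda>s. f s + c * w s) = integral\<^sup>L lborel f + c"
    using Bochner_Integration.integral_add[OF f_int integrable.intros[OF wc]]
      has_bochner_integral_integral_eq[OF wc] by simp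
  moreover have "beta_prime_mean n g r = integral\<^sup>L lborel (\<lambda>s. f s + c * w s)"
  proof -
    have e: "- int n - int r + 1 = - int (n + q)" by (simp add: Suc)
    have powi: "a powi (- int (n + q)) = 1 / a ^ (n + q)" for a :: real
      unfolding power_int_minus power_int_of_nat by (simp add: inverse_eq_divide)
    have "indicator {0..} s *\<^sub>R (s ^ q * (1 + s) powi (- int (n + q)) * g s) * C = f s + c * w s" for s
      unfolding powi f_def w_def by (simp add: algebra_simps diff_divide_distrib split: split_indicator)
    then have "(LINT s:{0..}|lborel. s ^ q * (1 + s) powi (- int (n + q)) * g s) * C
        = integral\<^sup>L lborel (\<lambda>s. f s + c * w s)"
      unfolding set_lebesgue_integral_def integral_mult_left_zero[symmetric] by simp
    then show ?thesis
      unfolding beta_prime_mean_def e by (simp add: Suc C_def mult_ac)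
  qed
  ultimately show ?thesis using le by simp
qed

section \<open>The even and the odd part of the Dunkl exponential\<close>

lemma dunkl_gamma_0: "\<nu> \<ge> 0 \<Longrightarrow> dunkl_gamma \<nu> 0 = 1"
  using Gamma_real_pos[of "\<nu> + 1 / 2"] by (simp add: dunkl_gamma_def less_imp_neq[symmetric])

text \<open>
  The functional equation of the Gamma function turns \<open>\<gamma>\<^sub>\<nu>\<close> into a factorial with the factor
  \<open>r + 2\<nu>\<close> in place of \<open>r\<close> for odd \<open>r\<close>; everything below uses \<open>\<gamma>\<^sub>\<nu>\<close> only through this recursion.
\<close>
lemma dunkl_gamma_Suc:
  assumes "\<nu> \<ge> 0"
  shows "dunkl_gamma \<nu> (Suc r) = (real (Suc r) + 2 * \<nu> * of_bool (even r)) * dunkl_gamma \<nu> r"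
proof (cases "even r")
  case True
  then obtain k where r: "r = 2 * k" by blast
  have "real k + \<nu> + 1 / 2 \<notin> \<int>\<^sub>\<le>\<^sub>0"
    using assms by (auto simp: nonpos_Ints_def)
  then have "Gamma (real k + \<nu> + 3 / 2) = (real k + \<nu> + 1 / 2) * Gamma (real k + \<nu> + 1 / 2)"
    using Gamma_plus1[of "real k + \<nu> + 1 / 2"] by (simp add: add.assoc)
  then show ?thesis by (simp add: r dunkl_gamma_def algebra_simps)
next
  case False
  then obtain k where r: "r = 2 * k + 1" by (elim oddE)
  have "real (Suc k) + \<nu> + 1 / 2 = real k + \<nu> + 3 / 2" by simp
  then show ?thesis by (simp add: r dunkl_gamma_def algebra_simps)
qed

lemma dunkl_gamma_ge_fact: "\<nu> \<ge> 0 \<Longrightarrow> dunkl_gamma \<nu> r \<ge> fact r"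
proof (induction r)
  case (Suc r)
  then show ?case
    unfolding dunkl_gamma_Suc[OF Suc.prems] fact_Suc by (intro mult_mono) auto
qed (simp add: dunkl_gamma_0)

lemma dunkl_gamma_pos: "\<nu> \<ge> 0 \<Longrightarrow> dunkl_gamma \<nu> r > 0"
  using dunkl_gamma_ge_fact[of \<nu> r] fact_gt_zero[of r, where 'a = real] by linarith

lemma summable_dunkl:
  fixes c :: "nat \<Rightarrow> real"
  assumes "\<nu> \<ge> 0" and "\<And>r. \<bar>c r\<bar> \<le> 1 / dunkl_gamma \<nu> r"
  shows "summable (\<lambda>r. c r * y ^ r)"
proof (rule summable_comparison_test')
  show "summable (\<lambda>r. inverse (fact r) * \<bar>y\<bar> ^ r)" by (rule summable_exp)
  show "norm (c r * y ^ r) \<le> inverse (fact r) * \<bar>y\<bar> ^ r" for r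
  proof -
    have "1 / dunkl_gamma \<nu> r \<le> inverse (fact r)"
      using dunkl_gamma_ge_fact[OF assms(1), of r] by (simp add: field_simps dunkl_gamma_pos assms)
    then show ?thesis
      using assms(2)[of r] by (simp add: abs_mult power_abs mult_right_mono)
  qed
qed

text \<open>
  Up to constants, \<open>dunkl_even\<close> and \<open>y * dunkl_odd_quot\<close> are \<open>y\<^bsup>1/2-\<nu>\<^esup>\<close> times the modified Bessel
  functions of order \<open>\<nu> - 1/2\<close> and \<open>\<nu> + 1/2\<close>. The odd part carries a factor \<open>y\<close>, which is split off
  so that no quotient by \<open>y\<close> occurs at \<open>y = 0\<close>.
\<close>
definition dunkl_even :: "real \<Rightarrow> real \<Rightarrow> real" where
  "dunkl_even \<nu> y = (\<Sum>r. of_bool (even r) / dunkl_gamma \<nu> r * y ^ r)"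

definition dunkl_odd_quot :: "real \<Rightarrow> real \<Rightarrow> real" where
  "dunkl_odd_quot \<nu> y = (\<Sum>r. of_bool (even r) / dunkl_gamma \<nu> (Suc r) * y ^ r)"

context
  fixes \<nu> :: real
  assumes nu: "\<nu> \<ge> 0"
begin

lemma dunkl_gamma_mono: "dunkl_gamma \<nu> r \<le> dunkl_gamma \<nu> (Suc r)"
proof -
  have "1 * dunkl_gamma \<nu> r \<le> dunkl_gamma \<nu> (Suc r)"
    unfolding dunkl_gamma_Suc[OF nu] using nu dunkl_gamma_pos[OF nu, of r] by (intro mult_right_mono) auto
  then show ?thesis by simp
qed

lemma dunkl_even_summable: "summable (\<lambda>r. of_bool (even r) / dunkl_gamma \<nu> r * y ^ r)"
  using dunkl_gamma_pos[OF nu] by (intro summable_dunkl[OF nu]) (auto simp: less_imp_le)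

lemma dunkl_odd_quot_summable: "summable (\<lambda>r. of_bool (even r) / dunkl_gamma \<nu> (Suc r) * y ^ r)"
  using dunkl_gamma_pos[OF nu] dunkl_gamma_mono
  by (intro summable_dunkl[OF nu]) (auto simp: less_imp_le frac_le)

lemma dunkl_even_sums: "(\<lambda>r. of_bool (even r) * (y ^ r / dunkl_gamma \<nu> r)) sums dunkl_even \<nu> y"
  using summable_sums[OF dunkl_even_summable[of y]] by (simp add: dunkl_even_def)

lemma dunkl_odd_sums: "(\<lambda>r. of_bool (odd r) * (y ^ r / dunkl_gamma \<nu> r)) sums (y * dunkl_odd_quot \<nu> y)"
proof -
  have "(\<lambda>r. y * (of_bool (even r) / dunkl_gamma \<nu> (Suc r) * y ^ r)) sums (y * dunkl_odd_quot \<nu> y)"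
    unfolding dunkl_odd_quot_def by (intro sums_mult summable_sums dunkl_odd_quot_summable)
  then show ?thesis
    using sums_Suc_iff[of "\<lambda>r. of_bool (odd r) * (y ^ r / dunkl_gamma \<nu> r)"] by (simp add: mult_ac)
qed

lemma dunkl_exp_sums: "(\<lambda>r. y ^ r / dunkl_gamma \<nu> r) sums dunkl_exp \<nu> y"
  unfolding dunkl_exp_def using summable_dunkl[OF nu, of "\<lambda>r. 1 / dunkl_gamma \<nu> r" y] dunkl_gamma_pos[OF nu]
  by (intro summable_sums) (auto simp: less_imp_le)

lemma dunkl_exp_split: "dunkl_exp \<nu> y = dunkl_even \<nu> y + y * dunkl_odd_quot \<nu> y"
  using sums_unique2[OF dunkl_exp_sums sums_cong[THEN iffD1, OF _ sums_add[OF dunkl_even_sums dunkl_odd_sums]]]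
  by (auto simp: distrib_right[symmetric])

lemma dunkl_even_pos: "y \<ge> 0 \<Longrightarrow> dunkl_even \<nu> y > 0"
  unfolding dunkl_even_def using dunkl_gamma_pos[OF nu]
  by (intro suminf_pos2[OF dunkl_even_summable, of _ 0]) (auto simp: less_imp_le)

lemma dunkl_odd_quot_nonneg: "y \<ge> 0 \<Longrightarrow> dunkl_odd_quot \<nu> y \<ge> 0"
  unfolding dunkl_odd_quot_def using dunkl_gamma_pos[OF nu]
  by (intro suminf_nonneg dunkl_odd_quot_summable) (auto simp: less_imp_le)

lemma DERIV_dunkl_even:
  "(dunkl_even \<nu> has_real_derivative y * dunkl_odd_quot \<nu> y) (at y)"
proof -
  have "diffs (\<lambda>r. of_bool (even r) / dunkl_gamma \<nu> r) r * y ^ r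
      = of_bool (odd r) * (y ^ r / dunkl_gamma \<nu> r)" for r
    using dunkl_gamma_pos[OF nu, of r] by (auto simp: diffs_def dunkl_gamma_Suc[OF nu])
  then have "(\<Sum>r. diffs (\<lambda>r. of_bool (even r) / dunkl_gamma \<nu> r) r * y ^ r) = y * dunkl_odd_quot \<nu> y"
    using sums_unique[OF dunkl_odd_sums[of y]] by simp
  then show ?thesis
    using termdiffs_strong_converges_everywhere[OF dunkl_even_summable, of y] unfolding dunkl_even_def
    by simp
qed

lemma DERIV_dunkl_odd:
  "((\<lambda>y. y * dunkl_odd_quot \<nu> y) has_real_derivative dunkl_even \<nu> y - 2 * \<nu> * dunkl_odd_quot \<nu> y) (at y)"
proof -
  have sm: "summable (\<lambda>r. of_bool (odd r) / dunkl_gamma \<nu> r * y ^ r)" for y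
    using sums_summable[OF dunkl_odd_sums[of y]] by simp
  have fn: "(\<lambda>y. \<Sum>r. of_bool (odd r) / dunkl_gamma \<nu> r * y ^ r) = (\<lambda>y. y * dunkl_odd_quot \<nu> y)"
    using sums_unique[OF dunkl_odd_sums] by auto
  have coeff: "diffs (\<lambda>r. of_bool (odd r) / dunkl_gamma \<nu> r) r * y ^ r
      = of_bool (even r) / dunkl_gamma \<nu> r * y ^ r
        - 2 * \<nu> * (of_bool (even r) / dunkl_gamma \<nu> (Suc r) * y ^ r)" for r
  proof (cases "even r")
    case True
    define c where "c = 1 + real r + 2 * \<nu>"
    have "c > 0" using nu by (simp add: c_def)
    have "real (Suc r) / (c * dunkl_gamma \<nu> r) = 1 / dunkl_gamma \<nu> r - 2 * \<nu> / (c * dunkl_gamma \<nu> r)"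
    proof -
      have "real (Suc r) = c - 2 * \<nu>" by (simp add: c_def)
      then show ?thesis using \<open>c > 0\<close> dunkl_gamma_pos[OF nu, of r] by (simp add: diff_divide_distrib)
    qed
    moreover have "dunkl_gamma \<nu> (Suc r) = c * dunkl_gamma \<nu> r"
      using True by (simp add: dunkl_gamma_Suc[OF nu] c_def)
    ultimately show ?thesis using True
      by (simp add: diffs_def left_diff_distrib[symmetric] mult.assoc[symmetric]
          del: of_nat_Suc distrib_right_numeral times_divide_eq_left)
  qed (simp add: diffs_def)
  have "(\<Sum>r. diffs (\<lambda>r. of_bool (odd r) / dunkl_gamma \<nu> r) r * y ^ r)
      = dunkl_even \<nu> y - 2 * \<nu> * dunkl_odd_quot \<nu> y"
    unfolding coeff dunkl_even_def dunkl_odd_quot_def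
    by (intro sums_unique[symmetric] sums_diff sums_mult summable_sums dunkl_even_summable dunkl_odd_quot_summable)
  then show ?thesis
    using termdiffs_strong_converges_everywhere[of "\<lambda>r. of_bool (odd r) / dunkl_gamma \<nu> r" y, OF sm]
    unfolding fn by simp
qed

lemma dunkl_odd_quot_differentiable: "\<exists>D. (dunkl_odd_quot \<nu> has_real_derivative D) (at y)"
  using termdiffs_strong_converges_everywhere[OF dunkl_odd_quot_summable, of y]
  unfolding dunkl_odd_quot_def by blast

text \<open>
  Write \<open>E\<close> for the even part, \<open>O = yU\<close> for the odd part and \<open>\<psi> = E\<^sup>2 - O\<^sup>2 - 2\<nu>UE\<close>. From
  \<open>E' = O\<close> and \<open>O' = E - 2\<nu>U\<close> one finds \<open>y\<psi>' = 2\<nu>(UE - \<psi>)\<close>, hence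
  \<open>(y\<^bsup>2\<nu>\<^esup>\<psi>)' = 2\<nu>y\<^bsup>2\<nu>-1\<^esup>UE \<ge> 0\<close>. As \<open>y\<^bsup>2\<nu>\<^esup>\<psi>\<close> vanishes at \<open>0\<close> for \<open>\<nu> > 0\<close>, it is nonnegative.
\<close>
lemma even_odd_gap:
  assumes "\<nu> > 0" and "y > 0"
  defines "E \<equiv> dunkl_even \<nu>" and "U \<equiv> dunkl_odd_quot \<nu>"
  shows "(E y)\<^sup>2 - (y * U y)\<^sup>2 \<ge> 2 * \<nu> * U y * E y"
proof -
  define \<psi> where "\<psi> = (\<lambda>t. (E t)\<^sup>2 - (t * U t)\<^sup>2 - 2 * \<nu> * U t * E t)"
  have deriv: "\<exists>D. ((\<lambda>t. t powr (2 * \<nu>) * \<psi> t) has_real_derivative D) (at t) \<and> 0 \<le> D"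
    if "0 < t" for t
  proof -
    obtain U' where U': "(U has_real_derivative U') (at t)"
      using dunkl_odd_quot_differentiable unfolding U_def by blast
    have E': "(E has_real_derivative t * U t) (at t)"
      using DERIV_dunkl_even[of t] unfolding E_def U_def .
    have O': "((\<lambda>t. t * U t) has_real_derivative E t - 2 * \<nu> * U t) (at t)"
      using DERIV_dunkl_odd[of t] unfolding E_def U_def .
    have prod: "((\<lambda>t. t * U t) has_real_derivative U t + t * U') (at t)"
      using DERIV_mult[OF DERIV_ident U'] by (simp add: mult.commute)
    \<comment> \<open>The derivative of \<open>U\<close> is only needed multiplied by \<open>t\<close>, and there it can be read off from the
      two forms of the derivative of \<open>tU\<close>.\<close>
    have tU': "t * U' = E t - 2 * \<nu> * U t - U t"
      using DERIV_unique[OF O' prod] by linarith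
    have \<psi>': "(\<psi> has_real_derivative (2 * E t * (t * U t) - 2 * (t * U t) * (E t - 2 * \<nu> * U t)
        - 2 * \<nu> * (U' * E t + U t * (t * U t)))) (at t)" (is "(_ has_real_derivative ?d) _")
      unfolding \<psi>_def
      using DERIV_diff[OF DERIV_diff[OF DERIV_power[OF E', of 2] DERIV_power[OF O', of 2]]
          DERIV_cmult[OF DERIV_mult[OF U' E'], of "2 * \<nu>"]]
      by (simp add: mult_ac add.commute)
    have td: "t * ?d = 2 * \<nu> * (U t * E t - \<psi> t)"
    proof -
      have "t * ?d = 2 * E t * t * (t * U t) - 2 * t * (t * U t) * (E t - 2 * \<nu> * U t)
        - 2 * \<nu> * (t * U' * E t + U t * t * (t * U t))" by (simp add: algebra_simps)
      also have "\<dots> = 2 * \<nu> * (U t * E t - \<psi> t)"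
        unfolding tU' \<psi>_def by (simp add: algebra_simps power2_eq_square)
      finally show ?thesis .
    qed
    have "((\<lambda>t. t powr (2 * \<nu>) * \<psi> t) has_real_derivative
        2 * \<nu> * t powr (2 * \<nu> - 1) * \<psi> t + ?d * t powr (2 * \<nu>)) (at t)"
      using DERIV_mult[OF has_real_derivative_powr[OF that, of "2 * \<nu>"] \<psi>'] by simp
    moreover have "2 * \<nu> * t powr (2 * \<nu> - 1) * \<psi> t + ?d * t powr (2 * \<nu>)
        = 2 * \<nu> * t powr (2 * \<nu> - 1) * (U t * E t)"
    proof -
      have shift: "t powr (2 * \<nu>) = t * t powr (2 * \<nu> - 1)" using that by (simp add: powr_diff)
      have "?d * (t * P) = 2 * \<nu> * (U t * E t - \<psi> t) * P" for P
        unfolding td[symmetric] by (simp only: mult_ac)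
      from this[of "t powr (2 * \<nu> - 1)"] show ?thesis
        unfolding shift by (simp only:) (simp add: algebra_simps)
    qed
    moreover have "0 \<le> 2 * \<nu> * t powr (2 * \<nu> - 1) * (U t * E t)"
      using nu that dunkl_even_pos[of t] dunkl_odd_quot_nonneg[of t] by (simp add: E_def U_def)
    ultimately show ?thesis by (intro exI conjI) (assumption, presburger)
  qed
  have "continuous_on {0..y} (\<lambda>t. t powr (2 * \<nu>) * \<psi> t)"
  proof (intro continuous_on_mult continuous_on_powr')
    have "isCont E t" for t
      unfolding E_def by (rule DERIV_isCont[OF DERIV_dunkl_even])
    moreover have "isCont U t" for t
    proof -
      obtain D where "(U has_real_derivative D) (at t)"
        using dunkl_odd_quot_differentiable unfolding U_def by blast
      then show ?thesis by (rule DERIV_isCont)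
    qed
    ultimately have "continuous_on {0..y} E" "continuous_on {0..y} U"
      by (simp_all add: continuous_at_imp_continuous_on)
    then show "continuous_on {0..y} \<psi>" unfolding \<psi>_def by (intro continuous_intros)
  qed (use \<open>\<nu> > 0\<close> in \<open>simp_all add: continuous_on_id\<close>)
  then have "0 powr (2 * \<nu>) * \<psi> 0 \<le> y powr (2 * \<nu>) * \<psi> y"
    using \<open>y > 0\<close> deriv by (intro DERIV_nonneg_imp_increasing_open[of 0 y "\<lambda>t. t powr (2 * \<nu>) * \<psi> t"]) simp_all
  then have "y powr (2 * \<nu>) * 0 \<le> y powr (2 * \<nu>) * \<psi> y" by simp
  then have "\<psi> y \<ge> 0" by (rule mult_left_le_imp_le) (use \<open>y > 0\<close> in simp)
  then show ?thesis by (simp add: \<psi>_def)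
qed

end

section \<open>Mean and variance of the Dunkl weights\<close>

text \<open>
  For \<open>\<nu> = 0\<close> these are the Poisson probabilities with parameter \<open>y\<close>.
\<close>
definition dunkl_prob :: "real \<Rightarrow> real \<Rightarrow> nat \<Rightarrow> real" where
  "dunkl_prob \<nu> y r = y ^ r / dunkl_gamma \<nu> r / dunkl_exp \<nu> y"

definition odd_prob :: "real \<Rightarrow> real \<Rightarrow> real" where
  "odd_prob \<nu> y = y * dunkl_odd_quot \<nu> y / dunkl_exp \<nu> y"

context
  fixes \<nu> y :: real
  assumes nu: "\<nu> \<ge> 0" and y: "y \<ge> 0"
begin

lemma dunkl_exp_pos: "dunkl_exp \<nu> y > 0"
  using dunkl_exp_split[OF nu, of y] dunkl_even_pos[OF nu y] dunkl_odd_quot_nonneg[OF nu y] y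
  by (simp add: add_pos_nonneg)

lemma dunkl_prob_nonneg: "dunkl_prob \<nu> y r \<ge> 0"
  using dunkl_exp_pos dunkl_gamma_pos[OF nu, of r] y by (simp add: dunkl_prob_def less_imp_le)

lemma dunkl_prob_sums: "dunkl_prob \<nu> y sums 1"
  using sums_divide[OF dunkl_exp_sums[OF nu, of y], of "dunkl_exp \<nu> y"] dunkl_exp_pos
  by (simp add: dunkl_prob_def[abs_def])

lemma odd_prob_sums: "(\<lambda>r. of_bool (odd r) * dunkl_prob \<nu> y r) sums odd_prob \<nu> y"
  using sums_divide[OF dunkl_odd_sums[OF nu, of y], of "dunkl_exp \<nu> y"]
  by (simp add: dunkl_prob_def odd_prob_def)

lemma odd_prob_nonneg: "odd_prob \<nu> y \<ge> 0"
  using dunkl_exp_pos dunkl_odd_quot_nonneg[OF nu y] y by (simp add: odd_prob_def)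

text \<open>
  This is the Stein identity of the distribution: it trades the factor \<open>r + 2\<nu>\<close> (odd \<open>r\<close>) or \<open>r\<close> (even
  \<open>r\<close>) for a factor \<open>y\<close> and an index shift, so used once it gives the mean, and used twice the second
  moment.
\<close>
lemma dunkl_prob_Suc:
  "(real (Suc r) + 2 * \<nu> * of_bool (even r)) * dunkl_prob \<nu> y (Suc r) = y * dunkl_prob \<nu> y r"
proof -
  define a where "a = real (Suc r) + 2 * \<nu> * of_bool (even r)"
  have "a > 0" using nu by (auto simp: a_def)
  then show ?thesis
    unfolding dunkl_prob_def dunkl_gamma_Suc[OF nu] a_def[symmetric] by simp
qed

lemma dunkl_mean_sums: "(\<lambda>r. real r * dunkl_prob \<nu> y r) sums (y - 2 * \<nu> * odd_prob \<nu> y)"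
proof -
  let ?f = "\<lambda>r. (real r + 2 * \<nu> * of_bool (odd r)) * dunkl_prob \<nu> y r"
  have "(\<lambda>r. ?f (Suc r)) sums y"
    using sums_mult[OF dunkl_prob_sums, of y] by (simp add: dunkl_prob_Suc[simplified])
  then have "?f sums y" using sums_Suc_iff[of ?f y] by simp
  from sums_diff[OF this sums_mult[OF odd_prob_sums, of "2 * \<nu>"]]
  show ?thesis by (simp add: algebra_simps)
qed

text \<open>
  Of two consecutive numbers exactly one is odd, so the product of the Stein factors of \<open>r\<close> and \<open>r - 1\<close>
  is \<open>r\<^sup>2 + (2\<nu> - 1)r\<close>, diminished by \<open>2\<nu>\<close> if \<open>r\<close> is odd. Its mean is \<open>y\<^sup>2\<close>.
\<close>
lemma dunkl_second_moment_sums: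
  "(\<lambda>r. (real r)\<^sup>2 * dunkl_prob \<nu> y r) sums
     (y\<^sup>2 + 2 * \<nu> * odd_prob \<nu> y + (1 - 2 * \<nu>) * (y - 2 * \<nu> * odd_prob \<nu> y))"
proof -
  let ?f = "\<lambda>r. ((real r)\<^sup>2 + (2 * \<nu> - 1) * real r - 2 * \<nu> * of_bool (odd r)) * dunkl_prob \<nu> y r"
  have step: "?f (Suc r) = y * ((real r + 2 * \<nu> * of_bool (odd r)) * dunkl_prob \<nu> y r)" for r
  proof -
    have "?f (Suc r) = (real r + 2 * \<nu> * of_bool (odd r)) *
        ((real (Suc r) + 2 * \<nu> * of_bool (even r)) * dunkl_prob \<nu> y (Suc r))"
      by (cases "even r") (simp_all add: algebra_simps power2_eq_square)
    then show ?thesis unfolding dunkl_prob_Suc by simp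
  qed
  have "(\<lambda>r. (real r + 2 * \<nu> * of_bool (odd r)) * dunkl_prob \<nu> y r) sums y"
    using sums_add[OF dunkl_mean_sums sums_mult[OF odd_prob_sums, of "2 * \<nu>"]] by (simp add: algebra_simps)
  from sums_mult[OF this, of y] have "(\<lambda>r. ?f (Suc r)) sums y\<^sup>2"
    unfolding step by (simp add: power2_eq_square)
  then have "?f sums y\<^sup>2" using sums_Suc_iff[of ?f] by simp
  from sums_add[OF sums_add[OF this sums_mult[OF odd_prob_sums, of "2 * \<nu>"]]
      sums_mult[OF dunkl_mean_sums, of "1 - 2 * \<nu>"]]
  show ?thesis by (simp add: algebra_simps)
qed

text \<open>
  Both are \<open>even_odd_gap\<close>, divided by the square of \<open>e\<^sub>\<nu>(y) = E + O\<close>.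
\<close>
lemma odd_prob_bounds:
  assumes "\<nu> > 0" and "y > 0"
  shows "2 * \<nu> * odd_prob \<nu> y * (1 - odd_prob \<nu> y) \<le> y * (1 - 2 * odd_prob \<nu> y)"
    and "odd_prob \<nu> y \<le> 1 / 2"
proof -
  define E U e where "E = dunkl_even \<nu> y" and "U = dunkl_odd_quot \<nu> y" and "e = dunkl_exp \<nu> y"
  have e: "e = E + y * U" "e > 0"
    using dunkl_exp_split[OF nu] dunkl_exp_pos by (auto simp: E_def U_def e_def)
  have "E > 0" "U \<ge> 0"
    using dunkl_even_pos[OF nu y] dunkl_odd_quot_nonneg[OF nu y] by (auto simp: E_def U_def)
  have A1: "odd_prob \<nu> y = y * U / e" by (simp add: odd_prob_def U_def e_def)
  have A2: "1 - odd_prob \<nu> y = E / e" and A3: "1 - 2 * odd_prob \<nu> y = (E - y * U) / e"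
  proof -
    have "1 - odd_prob \<nu> y = (e - y * U) / e" "1 - 2 * odd_prob \<nu> y = (e - 2 * (y * U)) / e"
      unfolding A1 using e(2) by (simp_all add: diff_divide_distrib)
    then show "1 - odd_prob \<nu> y = E / e" "1 - 2 * odd_prob \<nu> y = (E - y * U) / e"
      unfolding e(1) by simp_all
  qed
  have gap: "E\<^sup>2 - (y * U)\<^sup>2 \<ge> 2 * \<nu> * U * E"
    using even_odd_gap[OF nu assms] by (simp add: E_def U_def)
  have "0 \<le> 2 * \<nu> * U * E" using nu \<open>E > 0\<close> \<open>U \<ge> 0\<close> by simp
  with gap have "(y * U)\<^sup>2 \<le> E\<^sup>2" by linarith
  then have "y * U \<le> E" by (rule power2_le_imp_le) (use \<open>E > 0\<close> in simp)
  then show "odd_prob \<nu> y \<le> 1 / 2"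
    using A3 e(2) divide_nonneg_pos[of "E - y * U" e] by linarith
  have "2 * \<nu> * odd_prob \<nu> y * (1 - odd_prob \<nu> y) = y * (2 * \<nu> * U * E) / e\<^sup>2"
    unfolding A2 unfolding A1 by (simp add: power2_eq_square mult_ac)
  also have "\<dots> \<le> y * (E\<^sup>2 - (y * U)\<^sup>2) / e\<^sup>2"
    using mult_left_mono[OF gap y] by (rule divide_right_mono) simp
  also have "E\<^sup>2 - (y * U)\<^sup>2 = (E - y * U) * e"
    unfolding e(1) by (simp add: algebra_simps power2_eq_square)
  also have "y * ((E - y * U) * e) / e\<^sup>2 = y * (1 - 2 * odd_prob \<nu> y)"
    unfolding A3 using e(2) by (simp add: power2_eq_square)
  finally show "2 * \<nu> * odd_prob \<nu> y * (1 - odd_prob \<nu> y) \<le> y * (1 - 2 * odd_prob \<nu> y)" .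
qed

text \<open>
  With \<open>A\<close> the probability of an odd \<open>r\<close>, the variance is
  \<open>y - 2\<nu>(y(1 - 2A) - 2\<nu>A(1 - A))\<close>, and the bracket is nonnegative by \<open>odd_prob_bounds\<close>. Estimating
  \<open>A\<close> by constants would leave an error of order \<open>\<nu>\<^sup>2\<close>, which is not affordable when \<open>\<nu>\<close> is
  comparable to \<open>y\<close>.
\<close>
lemma dunkl_variance_le:
  assumes "y > 0"
  defines "m \<equiv> y - 2 * \<nu> * odd_prob \<nu> y"
  obtains V where "(\<lambda>r. (real r - m)\<^sup>2 * dunkl_prob \<nu> y r) sums V" and "V \<le> y"
proof
  define A where "A = odd_prob \<nu> y"
  have "(\<lambda>r. (real r - m)\<^sup>2 * dunkl_prob \<nu> y r) sums
      (y\<^sup>2 + 2 * \<nu> * A + (1 - 2 * \<nu>) * m - 2 * m * m + m\<^sup>2 * 1)"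
  proof -
    have "(\<lambda>r. real r * dunkl_prob \<nu> y r) sums m"
      "(\<lambda>r. (real r)\<^sup>2 * dunkl_prob \<nu> y r) sums (y\<^sup>2 + 2 * \<nu> * A + (1 - 2 * \<nu>) * m)"
      using dunkl_mean_sums dunkl_second_moment_sums by (simp_all add: m_def A_def)
    from sums_add[OF sums_diff[OF this(2) sums_mult[OF this(1), of "2 * m"]]
        sums_mult[OF dunkl_prob_sums, of "m\<^sup>2"]]
    show ?thesis by (simp add: power2_diff algebra_simps)
  qed
  moreover have "y\<^sup>2 + 2 * \<nu> * A + (1 - 2 * \<nu>) * m - 2 * m * m + m\<^sup>2 * 1
      = y - 2 * \<nu> * (y * (1 - 2 * A) - 2 * \<nu> * A * (1 - A))"
    unfolding m_def A_def[symmetric] by (simp add: algebra_simps power2_eq_square)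
  ultimately show "(\<lambda>r. (real r - m)\<^sup>2 * dunkl_prob \<nu> y r) sums
      (y - 2 * \<nu> * (y * (1 - 2 * A) - 2 * \<nu> * A * (1 - A)))" by (simp only:)
  show "y - 2 * \<nu> * (y * (1 - 2 * A) - 2 * \<nu> * A * (1 - A)) \<le> y"
  proof (cases "\<nu> = 0")
    case False
    with nu have "\<nu> > 0" by simp
    then have "0 \<le> y * (1 - 2 * A) - 2 * \<nu> * A * (1 - A)"
      using odd_prob_bounds(1)[OF _ \<open>y > 0\<close>] by (simp add: A_def)
    then show ?thesis using nu by simp
  qed simp
qed

lemma dunkl_mean_nonneg: "y - 2 * \<nu> * odd_prob \<nu> y \<ge> 0"
proof -
  have "0 \<le> (\<Sum>r. real r * dunkl_prob \<nu> y r)"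
    using dunkl_prob_nonneg by (intro suminf_nonneg sums_summable[OF dunkl_mean_sums]) auto
  then show ?thesis using sums_unique[OF dunkl_mean_sums] by simp
qed

end

section \<open>The operator as a mixture of beta prime averages\<close>

text \<open>
  The summands of \<open>T_op\<close> have indices from \<open>1\<close> on; its separate term \<open>g(0) / e\<^sub>\<nu>(nx)\<close> is the one of
  index \<open>0\<close>.
\<close>
lemma T_op_eq_mixture:
  assumes nu: "\<nu> \<ge> 0" and x: "x \<ge> 0" and n: "n \<ge> 2"
    and F: "(\<lambda>r. dunkl_prob \<nu> (real n * x) r * beta_prime_mean n g r) sums F"
  shows "T_op \<nu> n g x = F"
proof -
  define e where "e = dunkl_exp \<nu> (real n * x)"
  have "e > 0" using dunkl_exp_pos[OF nu, of "real n * x"] x by (simp add: e_def)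
  let ?f = "\<lambda>r. dunkl_prob \<nu> (real n * x) r * beta_prime_mean n g r"
  have f0: "?f 0 = g 0 / e"
    using nu by (simp add: dunkl_prob_def beta_prime_mean_def dunkl_gamma_0 e_def)
  have fSuc: "?f (Suc r) = (real n - 1) / e * T_term \<nu> n g x (Suc r)" for r
    by (simp add: dunkl_prob_def beta_prime_mean_def T_term_def e_def mult_ac)
  have ne: "(real n - 1) / e \<noteq> 0" using n \<open>e > 0\<close> by simp
  have "(\<lambda>r. ?f (Suc r)) sums (F - g 0 / e)"
    using F sums_Suc_iff[of ?f "F - g 0 / e"] f0 by simp
  then have s: "(\<lambda>r. (real n - 1) / e * T_term \<nu> n g x (Suc r)) sums (F - g 0 / e)"
    unfolding fSuc .
  have "summable (\<lambda>r. T_term \<nu> n g x (Suc r))"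
    using sums_summable[OF s] ne by (subst (asm) summable_cmult_iff) simp
  then have "(real n - 1) / e * (\<Sum>r. T_term \<nu> n g x (Suc r)) = F - g 0 / e"
    using sums_unique2[OF s sums_mult[OF summable_sums]] by simp
  then show ?thesis unfolding T_op_def e_def[symmetric] by simp
qed

text \<open>
  A quadratic bound in \<open>r\<close>, centred at the mean of \<open>r\<close>, loses its linear term on averaging, and the
  quadratic one picks up the variance, which is at most \<open>nx\<close>.
\<close>
lemma T_op_deviation:
  assumes nu: "\<nu> \<ge> 0" and x: "x > 0" and n: "n \<ge> 2"
  defines "m \<equiv> real n * x - 2 * \<nu> * odd_prob \<nu> (real n * x)"
  assumes quad: "\<And>r. \<bar>beta_prime_mean n g r - c\<bar> \<le> c0 + c1 * (real r - m) + c2 * (real r - m)\<^sup>2"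
    and c2: "c2 \<ge> 0"
  shows "\<bar>T_op \<nu> n g x - c\<bar> \<le> c0 + c2 * (real n * x)"
proof -
  define y where "y = real n * x"
  have y: "y > 0" "y \<ge> 0" using x n by (auto simp: y_def)
  define p where "p = dunkl_prob \<nu> y"
  have p: "p r \<ge> 0" for r unfolding p_def by (rule dunkl_prob_nonneg[OF nu y(2)])
  have p1: "p sums 1" unfolding p_def by (rule dunkl_prob_sums[OF nu y(2)])
  have pm: "(\<lambda>r. real r * p r) sums m"
    using dunkl_mean_sums[OF nu y(2)] by (simp add: p_def m_def y_def)
  obtain V where V: "(\<lambda>r. (real r - m)\<^sup>2 * p r) sums V" "V \<le> y"
    using dunkl_variance_le[OF nu y(2,1)] unfolding p_def m_def y_def by blast
  have "(\<lambda>r. real r * p r - m * p r) sums (m - m * 1)" by (intro sums_diff sums_mult p1 pm)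
  then have centred: "(\<lambda>r. (real r - m) * p r) sums 0" by (simp add: left_diff_distrib)
  let ?q = "\<lambda>r. c0 + c1 * (real r - m) + c2 * (real r - m)\<^sup>2"
  have "(\<lambda>r. c0 * p r + c1 * ((real r - m) * p r) + c2 * ((real r - m)\<^sup>2 * p r))
      sums (c0 * 1 + c1 * 0 + c2 * V)"
    by (intro sums_add sums_mult p1 centred V)
  moreover have "c0 * p r + c1 * (d * p r) + c2 * (e * p r) = p r * (c0 + c1 * d + c2 * e)" for r d e
    by (simp add: algebra_simps)
  ultimately have q: "(\<lambda>r. p r * ?q r) sums (c0 + c2 * V)" by simp
  let ?d = "\<lambda>r. p r * (beta_prime_mean n g r - c)"
  have d_le: "\<bar>?d r\<bar> \<le> p r * ?q r" for r
  proof -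
    have "\<bar>?d r\<bar> = p r * \<bar>beta_prime_mean n g r - c\<bar>" using p[of r] by (simp add: abs_mult)
    then show ?thesis using mult_left_mono[OF quad p] by (simp only:)
  qed
  have d_sum: "summable (\<lambda>r. \<bar>?d r\<bar>)"
    by (rule summable_comparison_test'[OF sums_summable[OF q]]) (simp only: real_norm_def abs_abs d_le)
  have d: "?d sums (\<Sum>r. ?d r)" by (rule summable_sums[OF summable_rabs_cancel[OF d_sum]])
  have "(\<lambda>r. ?d r + c * p r) sums ((\<Sum>r. ?d r) + c * 1)" by (intro sums_add sums_mult d p1)
  moreover have "?d r + c * p r = p r * beta_prime_mean n g r" for r by (simp add: algebra_simps)
  ultimately have "(\<lambda>r. p r * beta_prime_mean n g r) sums ((\<Sum>r. ?d r) + c)" by (simp only: mult_1_right)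
  then have "T_op \<nu> n g x = (\<Sum>r. ?d r) + c"
    using nu x n unfolding p_def y_def by (intro T_op_eq_mixture) auto
  then have "\<bar>T_op \<nu> n g x - c\<bar> = \<bar>\<Sum>r. ?d r\<bar>" by simp
  also have "\<dots> \<le> (\<Sum>r. \<bar>?d r\<bar>)" by (rule summable_rabs[OF d_sum])
  also have "\<dots> \<le> (\<Sum>r. p r * ?q r)" by (intro suminf_le d_le d_sum sums_summable[OF q])
  also have "\<dots> = c0 + c2 * V" using sums_unique[OF q] by simp
  also have "\<dots> \<le> c0 + c2 * y" using V(2) c2 by (simp add: mult_left_mono)
  finally show ?thesis by (simp add: y_def)
qed

section \<open>The rate of approximation\<close>

text \<open>
  The bracket is \<open>(s - u)\<^sup>2 / (1 + s)\<close>, written in the functions whose beta prime means are known.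
  The claim is the inequality between arithmetic and geometric mean for \<open>l(s - u)\<^sup>2 / (1 + s)\<close> and
  \<open>(1 + s) / l\<close>. On averaging and optimising in \<open>l\<close> it becomes the Cauchy--Schwarz inequality with
  weight \<open>1 + s\<close>.
\<close>
lemma weighted_deviation_bound:
  fixes s u l :: real
  assumes "l > 0" and "s \<ge> 0"
  shows "\<bar>s - u\<bar> \<le> l / 2 * ((1 + s) - 2 * (1 + u) + (1 + u)\<^sup>2 / (1 + s)) + (1 + s) / (2 * l)"
proof -
  define v where "v = 1 + s"
  have "v > 0" using assms by (simp add: v_def)
  define t where "t = \<bar>s - u\<bar>"
  have t2: "t\<^sup>2 = v\<^sup>2 - 2 * (1 + u) * v + (1 + u)\<^sup>2"
    by (simp add: t_def v_def power2_eq_square algebra_simps)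
  have "0 \<le> (l * t - v)\<^sup>2 / (2 * l * v)" using assms \<open>v > 0\<close> by simp
  also have "\<dots> = l / 2 * (t\<^sup>2 / v) + v / (2 * l) - t"
    using assms \<open>v > 0\<close> by (simp add: power2_eq_square field_simps)
  also have "t\<^sup>2 / v = v - 2 * (1 + u) + (1 + u)\<^sup>2 / v"
    unfolding t2 using \<open>v > 0\<close> by (simp add: power2_eq_square field_simps)
  finally show ?thesis by (simp add: t_def v_def)
qed

text \<open>
  The tangent of \<open>1 / z\<close> at \<open>w\<close> falls short of \<open>1 / z\<close> by exactly \<open>(z - w)\<^sup>2 / (w\<^sup>2z)\<close>, and
  \<open>k / z \<le> 1\<close> in this remainder.
\<close>
lemma reciprocal_quadratic_bound:
  fixes k z w :: real
  assumes "0 < k" "k \<le> z" "0 < w"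
  shows "k / z \<le> (k * (2 * w - z) + (z - w)\<^sup>2) / w\<^sup>2"
proof -
  have "k * w\<^sup>2 = z * (k * (2 * w - z)) + k * (z - w)\<^sup>2"
    by (simp add: power2_eq_square algebra_simps)
  also have "\<dots> \<le> z * (k * (2 * w - z)) + z * (z - w)\<^sup>2"
    using assms by (simp add: mult_right_mono)
  also have "\<dots> = (k * (2 * w - z) + (z - w)\<^sup>2) * z" by (simp add: algebra_simps)
  finally have "k \<le> (k * (2 * w - z) + (z - w)\<^sup>2) * z / w\<^sup>2"
    using assms by (subst pos_le_divide_eq) auto
  then show ?thesis using assms by (subst pos_divide_le_eq) auto
qed

text \<open>
  Let \<open>q\<^sup>2\<close> be \<open>n\<close> times the radicand on the left and \<open>k = n / (n - 2)\<close>, so that \<open>1 \<le> k \<le> 2\<close>. In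
  \<open>(\<surd>n \<beta> + q)\<^sup>2 = n\<beta>\<^sup>2 + q\<^sup>2 + 2\<surd>n \<beta>q\<close> the mixed term is controlled by
  \<open>2\<surd>n q \<le> 1 + 8nu + 7n\<beta>\<close>. The coefficient \<open>8\<nu> \<ge> 8n\<beta>\<close> of \<open>x = u + \<beta>\<close> on the right pays for
  \<open>8nu\<beta>\<close> and \<open>n\<beta>\<^sup>2 + 7n\<beta>\<^sup>2\<close>, and the difference of \<open>2kx\<close> and \<open>2ku\<close> pays for the remaining
  multiples of \<open>\<beta>\<close>. What is left is \<open>2k\<^sup>2u\<^sup>2 + ku\<beta>\<close>, which is at most \<open>9x\<^sup>2\<close>.
\<close>
lemma bias_plus_root_le:
  fixes n u \<beta> \<nu> :: real
  assumes "n \<ge> 4" "u \<ge> 0" "\<beta> \<ge> 0" "\<nu> \<ge> n * \<beta>"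
  shows "sqrt n * (\<beta> + sqrt ((2 * u / (n - 2) + \<beta> / n) * (1 + n * u / (n - 2))))
    \<le> sqrt (9 * (u + \<beta>)\<^sup>2 + ((8 * \<nu> * n - 12 * \<nu> + 2 * n) / (n - 2)) * (u + \<beta>))"
proof -
  define k where "k = n / (n - 2)"
  have k: "1 \<le> k" "k \<le> 2" using assms by (auto simp: k_def field_simps)
  define q2 where "q2 = (2 * k * u + \<beta>) * (1 + k * u)"
  have q2: "n * ((2 * u / (n - 2) + \<beta> / n) * (1 + n * u / (n - 2))) = q2"
  proof -
    have "n * (2 * u / (n - 2) + \<beta> / n) = 2 * k * u + \<beta>"
      using assms by (simp add: k_def distrib_left)
    then show ?thesis by (simp add: q2_def k_def mult.assoc[symmetric])
  qed
  have "q2 \<ge> 0" using assms k by (auto simp: q2_def)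
  have k2: "k\<^sup>2 \<le> 4" using k power_mono[of k 2 2] by simp
  have q2_le: "q2 \<le> (4 * u + \<beta>) * (1 + 2 * u)"
    unfolding q2_def using assms k by (intro mult_mono add_mono mult_right_mono) auto
  have "4 * n * q2 \<le> (1 + 8 * n * u + 7 * n * \<beta>)\<^sup>2"
  proof -
    have nn: "n * n \<ge> n * 1" using assms by (intro mult_left_mono) auto
    have a: "32 * n * u\<^sup>2 \<le> 64 * (n * n) * u\<^sup>2" using nn assms by (intro mult_right_mono) auto
    have b: "8 * n * (u * \<beta>) \<le> 112 * (n * n) * (u * \<beta>)" using nn assms by (intro mult_right_mono) auto
    have c: "0 \<le> 49 * (n * n) * (\<beta> * \<beta>)" "0 \<le> n * \<beta>" using assms by auto
    have "4 * n * q2 \<le> 4 * n * ((4 * u + \<beta>) * (1 + 2 * u))" using q2_le assms by (intro mult_left_mono) auto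
    also have "\<dots> = 16 * n * u + 4 * n * \<beta> + 32 * n * u\<^sup>2 + 8 * n * (u * \<beta>)" by (simp add: algebra_simps power2_eq_square)
    also have "\<dots> \<le> 1 + 16 * n * u + 14 * n * \<beta> + 64 * (n * n) * u\<^sup>2 + 112 * (n * n) * (u * \<beta>)
         + 49 * (n * n) * (\<beta> * \<beta>)" using a b c by linarith
    also have "\<dots> = (1 + 8 * n * u + 7 * n * \<beta>)\<^sup>2" by (simp add: algebra_simps power2_eq_square)
    finally show ?thesis .
  qed
  then have "sqrt (4 * n * q2) \<le> 1 + 8 * n * u + 7 * n * \<beta>"
    using assms by (intro real_le_lsqrt) auto
  then have cross: "2 * sqrt n * sqrt q2 \<le> 1 + 8 * n * u + 7 * n * \<beta>"
    by (simp add: real_sqrt_mult)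
  define c where "c = (8 * \<nu> * n - 12 * \<nu> + 2 * n) / (n - 2)"
  have c: "c \<ge> 2 * k + 8 * n * \<beta>"
  proof -
    have "c = 2 * k + \<nu> * ((8 * n - 12) / (n - 2))" by (simp add: c_def k_def add_divide_distrib diff_divide_distrib algebra_simps)
    moreover have "(8 * n - 12) / (n - 2) \<ge> 8" using assms by (simp add: field_simps)
    moreover have "\<nu> * ((8 * n - 12) / (n - 2)) \<ge> (n * \<beta>) * 8"
      using assms calculation by (intro mult_mono) (auto intro: order_trans[of 0 "n * \<beta>"])
    ultimately show ?thesis by simp
  qed
  have "(sqrt n * \<beta> + sqrt q2)\<^sup>2 = n * \<beta>\<^sup>2 + q2 + \<beta> * (2 * sqrt n * sqrt q2)"
    using assms \<open>q2 \<ge> 0\<close> by (simp add: power2_sum power_mult_distrib)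
  also have "\<dots> \<le> n * \<beta>\<^sup>2 + q2 + \<beta> * (1 + 8 * n * u + 7 * n * \<beta>)"
    using cross assms by (intro add_left_mono mult_left_mono) auto
  also have "\<dots> = 2 * k * u + 2 * k\<^sup>2 * u\<^sup>2 + 2 * \<beta> + k * (u * \<beta>) + 8 * n * (u * \<beta>) + 8 * n * \<beta>\<^sup>2"
    by (simp add: q2_def algebra_simps power2_eq_square)
  also have "\<dots> \<le> 9 * (u + \<beta>)\<^sup>2 + (2 * k + 8 * n * \<beta>) * (u + \<beta>)"
  proof -
    have "k\<^sup>2 * u\<^sup>2 \<le> 4 * u\<^sup>2" "\<beta> \<le> k * \<beta>" "k * (u * \<beta>) \<le> 2 * (u * \<beta>)" "0 \<le> u\<^sup>2" "0 \<le> \<beta>\<^sup>2" "0 \<le> u * \<beta>"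
      using k k2 assms mult_right_mono[of 1 k \<beta>] by (auto intro: mult_right_mono)
    moreover have "9 * (u + \<beta>)\<^sup>2 + (2 * k + 8 * n * \<beta>) * (u + \<beta>) =
      9 * u\<^sup>2 + 18 * (u * \<beta>) + 9 * \<beta>\<^sup>2 + 2 * k * u + 2 * (k * \<beta>) + 8 * n * (u * \<beta>) + 8 * n * \<beta>\<^sup>2"
      by (simp add: algebra_simps power2_eq_square)
    ultimately show ?thesis by linarith
  qed
  also have "\<dots> \<le> 9 * (u + \<beta>)\<^sup>2 + c * (u + \<beta>)"
    using c assms by (intro add_left_mono mult_right_mono) auto
  finally have "sqrt n * \<beta> + sqrt q2 \<le> sqrt (9 * (u + \<beta>)\<^sup>2 + c * (u + \<beta>))"
    by (rule real_le_rsqrt)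
  then show ?thesis
    unfolding c_def distrib_left[of "sqrt n"] real_sqrt_mult[symmetric] q2 .
qed

theorem theorem7:
  fixes \<nu> x :: real and n :: nat and g :: "real \<Rightarrow> real"
  assumes "\<nu> \<ge> 0"
    and "uniformly_continuous_on {0..} g"
    and "g \<in> quadratic_growth_space"
    and "n > 3"
    and "x \<ge> 0"
  shows "\<bar>T_op \<nu> n g x - g x\<bar> \<le>
    (1 + sqrt (9 * x\<^sup>2 + ((8 * \<nu> * real n - 12 * \<nu> + 2 * real n) / (real n - 2)) * x))
    * modulus_of_continuity g (1 / sqrt (real n))"
proof -
  define N where "N = real n"
  have N: "N \<ge> 4" using \<open>n > 3\<close> by (simp add: N_def)
  define W where "W = modulus_of_continuity g (1 / sqrt N)"
  have W: "W \<ge> 0"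
    using modulus_of_continuity_upper[OF assms(2), of 0 0 "1 / sqrt N"] N by (simp add: W_def)
  show ?thesis
  proof (cases "x = 0")
    case True
    have "dunkl_exp \<nu> 0 = 1"
      using powser_zero[of "\<lambda>r. 1 / dunkl_gamma \<nu> r"] dunkl_gamma_0[OF assms(1)]
      by (simp add: dunkl_exp_def)
    moreover have "T_term \<nu> n g 0 (Suc r) = 0" for r by (simp add: T_term_def)
    ultimately have "T_op \<nu> n g 0 = g 0" by (simp add: T_op_def)
    then show ?thesis using True W by (simp add: W_def N_def)
  next
    case False
    then have x: "x > 0" using \<open>x \<ge> 0\<close> by simp
    then have y: "N * x > 0" "N * x \<ge> 0" using N by auto
    define A where "A = odd_prob \<nu> (N * x)"
    define \<beta> where "\<beta> = 2 * \<nu> * A / N"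
    define u where "u = x - \<beta>"
    have m: "N * x - 2 * \<nu> * A = N * u" using N by (simp add: u_def \<beta>_def algebra_simps)
    have "N * u \<ge> 0" using dunkl_mean_nonneg[OF assms(1) y(2)] m by (simp add: A_def)
    then have u: "u \<ge> 0" using N by (simp add: zero_le_mult_iff)
    have "A \<ge> 0" using odd_prob_nonneg[OF assms(1) y(2)] by (simp add: A_def)
    then have \<beta>: "\<beta> \<ge> 0" using assms(1) N by (simp add: \<beta>_def)
    have \<nu>: "\<nu> \<ge> N * \<beta>"
    proof (cases "\<nu> = 0")
      case False
      then have "A \<le> 1 / 2" using odd_prob_bounds(2)[OF assms(1) y(2) _ y(1)] assms(1) by (simp add: A_def)
      then have "\<nu> * (2 * A) \<le> \<nu> * 1" using assms(1) by (intro mult_left_mono) auto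
      then show ?thesis using N by (simp add: \<beta>_def mult_ac)
    qed (simp add: \<beta>_def)
    \<comment> \<open>\<open>K\<close> bounds the mean of \<open>(s - u)\<^sup>2 / (1 + s)\<close>, and \<open>S\<close> is the mean of \<open>1 + s\<close>; \<open>l\<close> is the
      multiplier that makes both terms of \<open>weighted_deviation_bound\<close> equal.\<close>
    define K where "K = 2 * u / (N - 2) + \<beta> / N"
    define S where "S = 1 + N * u / (N - 2)"
    have S: "S > 0" using u N by (simp add: S_def add_pos_nonneg)
    have K: "K > 0"
    proof (cases "u > 0")
      case True
      then show ?thesis using \<beta> N by (simp add: K_def add_pos_nonneg)
    next
      case False
      then have "\<beta> > 0" using u x by (simp add: u_def)
      then show ?thesis using u N by (simp add: K_def add_nonneg_pos)
    qed
    define l where "l = sqrt (S / K)"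
    have l: "l > 0" using S K by (simp add: l_def)
    have l_opt: "l / 2 * K + S / (2 * l) = sqrt (K * S)"
    proof -
      have "l\<^sup>2 * K = S" using S K by (simp add: l_def)
      then have lK: "S / l = l * K" using l by (simp add: power2_eq_square field_simps)
      have "(l * K)\<^sup>2 = K * S" using \<open>l\<^sup>2 * K = S\<close> by (simp add: power2_eq_square mult_ac)
      then have "sqrt (K * S) = l * K" using l K by (intro real_sqrt_unique) auto
      moreover have "S / (2 * l) = S / l / 2" by simp
      ultimately show ?thesis unfolding lK by simp
    qed
    define a where "a = W * sqrt N * (l / 2 + 1 / (2 * l))"
    define b where "b = W * sqrt N * (l / 2) * (1 + u)\<^sup>2"
    define k where "k = W + W * sqrt N * (\<beta> - l * (1 + u))"
    have pointwise: "\<bar>g s - g x\<bar> \<le> a * (1 + s) + b / (1 + s) + k" if "s \<ge> 0" for s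
    proof -
      have "\<bar>s - x\<bar> \<le> \<bar>s - u\<bar> + \<beta>" using \<beta> by (simp add: u_def)
      also have "\<dots> \<le> l / 2 * ((1 + s) - 2 * (1 + u) + (1 + u)\<^sup>2 / (1 + s)) + (1 + s) / (2 * l) + \<beta>"
        using weighted_deviation_bound[OF l that, of u] by simp
      finally have dev: "\<bar>s - x\<bar> \<le> \<dots>" .
      have "\<bar>g s - g x\<bar> \<le> (1 + \<bar>s - x\<bar> / (1 / sqrt N)) * W"
        unfolding W_def using assms(2,5) N that by (intro modulus_of_continuity_bound) auto
      also have "\<dots> = W + W * sqrt N * \<bar>s - x\<bar>" by (simp add: algebra_simps)
      also have "\<dots> \<le> W + W * sqrt N *
          (l / 2 * ((1 + s) - 2 * (1 + u) + (1 + u)\<^sup>2 / (1 + s)) + (1 + s) / (2 * l) + \<beta>)"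
        using dev W N by (intro add_left_mono mult_left_mono) auto
      also have "\<dots> = a * (1 + s) + b / (1 + s) + k"
        unfolding a_def b_def k_def by (simp add: algebra_simps)
      finally show ?thesis .
    qed
    define c2 where "c2 = W * sqrt N * (l / 2) / N\<^sup>2"
    define c1 where "c1 = a / (N - 2) - c2 * (N + 1)"
    define c0 where "c0 = a * S + c2 * ((N - 1) * (N * (1 + u) + 1) + 1) + k"
    have "c2 \<ge> 0" using W N l by (simp add: c2_def)
    \<comment> \<open>The reference point \<open>w = n(1 + u)\<close> for the reciprocal is one more than the mean of
      \<open>n - 1 + r\<close>. With it, a variance of \<open>nu\<close> would give exactly \<open>1 / (1 + u)\<close> as the bound for the
      mean of \<open>1 / (1 + s)\<close>.\<close>
    have quad: "\<bar>beta_prime_mean n g r - g x\<bar> \<le> c0 + c1 * (real r - N * u) + c2 * (real r - N * u)\<^sup>2" for r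
    proof -
      define d where "d = real r - N * u"
      define w where "w = N * (1 + u)"
      have w: "w > 0" using N u by (simp add: w_def)
      have z: "N - 1 + real r = w - 1 + d" by (simp add: w_def d_def algebra_simps)
      have "(N - 1) / (N - 1 + real r) \<le> ((N - 1) * (2 * w - (w - 1 + d)) + (w - 1 + d - w)\<^sup>2) / w\<^sup>2"
        unfolding z[symmetric] using N w by (intro reciprocal_quadratic_bound) auto
      also have "(N - 1) * (2 * w - (w - 1 + d)) + (w - 1 + d - w)\<^sup>2
          = (N - 1) * (w + 1) + 1 - (N + 1) * d + d\<^sup>2"
        by (simp add: power2_eq_square algebra_simps)
      finally have recip: "(N - 1) / (N - 1 + real r)
          \<le> ((N - 1) * (w + 1) + 1 - (N + 1) * d + d\<^sup>2) / w\<^sup>2" .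
      have "b \<ge> 0" using W N l by (simp add: b_def)
      have "b * ((N - 1) / (N - 1 + real r))
          \<le> b * (((N - 1) * (w + 1) + 1 - (N + 1) * d + d\<^sup>2) / w\<^sup>2)"
        by (intro mult_left_mono recip \<open>b \<ge> 0\<close>)
      also have "\<dots> = c2 * ((N - 1) * (w + 1) + 1 - (N + 1) * d + d\<^sup>2)"
      proof -
        have "(1 + u)\<^sup>2 / w\<^sup>2 = 1 / N\<^sup>2" using u N by (simp add: w_def power_mult_distrib)
        moreover have "b / w\<^sup>2 = W * sqrt N * (l / 2) * ((1 + u)\<^sup>2 / w\<^sup>2)"
          unfolding b_def by (simp only: times_divide_eq_right)
        ultimately have "b / w\<^sup>2 = c2" by (simp only: c2_def times_divide_eq_right mult_1_right)
        then show ?thesis by (simp only: times_divide_eq_right times_divide_eq_left[symmetric])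
      qed
      finally have 2: "b * ((N - 1) / (N - 1 + real r))
          \<le> c2 * ((N - 1) * (w + 1) + 1 - (N + 1) * d + d\<^sup>2)" .
      have 1: "a * (1 + real r / (N - 2)) = a * S + a / (N - 2) * d"
        by (simp add: S_def d_def algebra_simps add_divide_distrib diff_divide_distrib)
      have "\<bar>beta_prime_mean n g r - g x\<bar>
          \<le> a * (1 + real r / (N - 2)) + b * ((N - 1) / (N - 1 + real r)) + k"
        unfolding N_def using \<open>n > 3\<close> assms(2) pointwise
        by (intro beta_prime_mean_bound uniformly_continuous_imp_continuous) auto
      also have "\<dots> \<le> a * S + a / (N - 2) * d + c2 * ((N - 1) * (w + 1) + 1 - (N + 1) * d + d\<^sup>2) + k"
        using 1 2 by simp
      also have "\<dots> = c0 + c1 * d + c2 * d\<^sup>2"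
        unfolding c0_def c1_def w_def[symmetric] by (simp add: algebra_simps)
      finally show ?thesis by (simp add: d_def)
    qed
    have "\<bar>T_op \<nu> n g x - g x\<bar> \<le> c0 + c2 * (real n * x)"
    proof (rule T_op_deviation[OF assms(1) x])
      show "\<bar>beta_prime_mean n g r - g x\<bar>
          \<le> c0 + c1 * (real r - (real n * x - 2 * \<nu> * odd_prob \<nu> (real n * x)))
            + c2 * (real r - (real n * x - 2 * \<nu> * odd_prob \<nu> (real n * x)))\<^sup>2" for r
        using quad[of r, folded m] unfolding A_def N_def .
    qed (use \<open>n > 3\<close> \<open>c2 \<ge> 0\<close> in auto)
    also have "\<dots> = W * (1 + sqrt N * (\<beta> + sqrt (K * S)))"
    proof -
      have x_eq: "x = u + \<beta>" by (simp add: u_def)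
      have "(N - 1) * (N * (1 + u) + 1) + 1 + N * x = N\<^sup>2 * (1 + u + \<beta> / N)"
        unfolding x_eq using N by (simp add: power2_eq_square algebra_simps)
      then have sum: "c2 * ((N - 1) * (N * (1 + u) + 1) + 1 + N * x) = W * sqrt N * (l / 2) * (1 + u + \<beta> / N)"
        unfolding c2_def using N by simp
      have "K = S - (1 + u) + \<beta> / N"
      proof -
        have "N * u / (N - 2) = u + 2 * u / (N - 2)"
        proof -
          have "N * u = (N - 2) * u + 2 * u" by (simp add: algebra_simps)
          then show ?thesis using N by (simp only: add_divide_distrib) simp
        qed
        then show ?thesis by (simp add: K_def S_def)
      qed
      then have "1 + u + \<beta> / N = 2 * (1 + u) + K - S" by simp
      with sum have "c2 * ((N - 1) * (N * (1 + u) + 1) + 1 + N * x)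
          = W * sqrt N * (l / 2) * (2 * (1 + u) + K - S)" by (simp only:)
      then have "c0 + c2 * (N * x)
          = a * S + W * sqrt N * (l / 2) * (2 * (1 + u) + K - S) + k"
        unfolding c0_def by (simp only: distrib_left)
      also have "\<dots> = W + W * sqrt N * (\<beta> + (l / 2 * K + S / (2 * l)))"
        unfolding a_def k_def by (simp add: algebra_simps)
      finally have "c0 + c2 * (N * x) = W + W * sqrt N * (\<beta> + (l / 2 * K + S / (2 * l)))" .
      then show ?thesis unfolding l_opt by (simp add: N_def algebra_simps)
    qed
    also have "\<dots> \<le> W * (1 + sqrt (9 * (u + \<beta>)\<^sup>2
        + ((8 * \<nu> * N - 12 * \<nu> + 2 * N) / (N - 2)) * (u + \<beta>)))"
      unfolding K_def S_def
      by (intro mult_left_mono add_left_mono bias_plus_root_le W N u \<beta> \<nu>)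
    also have "u + \<beta> = x" by (simp add: u_def)
    finally show ?thesis by (simp add: W_def N_def mult.commute)
  qed
qed

end
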